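(* Let $M$ be a faithful left $R$-module over a prime ring $R$. In any of the following cases $M$ is torsionless and hence has a prime endomorphism ring $\mathrm{End}_R(M)$: (1) $M$ is a $*$-prime module and is not a singular left $R$-module. (2) $M$ is a $*$-prime module and $R$ is a left duo ring, i.e. any left ideal of $R$ is two-sided. (3) $M$ is non-singular and is cogenerated by each of its essential submodules.
   Context: Rings are associative and unital. Homomorphisms of left modules are written on the right of their arguments. For submodules $N,L$ of $M$ put $N*L = N\,\mathrm{Hom}_R(M,L)=\sum\{(N)f \mid f\in \mathrm{Hom}_R(M,L)\}$. $M$ is called $*$-prime if $N*L\neq 0$ for all non-zero submodules $N,L$ of $M$. A module $M$ is cogenerated by a module $U$ if $M$ embeds in a direct product of copies of $U$; $M$ is torsionless if it is cogenerated by $R$. An element of $M$ is singular if its annihilator is an essential left ideal of $R$; $M$ is singular if all its elements are singular, and non-singular if $0$ is its only singular element. *)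

theory Defs
  imports "HOL-Algebra.Module" "HOL-Algebra.Ideal_Product"
begin

text \<open>HOL-Algebra's locale \<open>module\<close> requires a commutative ring of scalars; here the scalars form
  an arbitrary ring. As in the library, the fields \<open>mult\<close> and \<open>one\<close> of a module record play no
  role. The predicate \<open>submodule\<close> of the library does not use commutativity of the scalars and is
  used as it stands.\<close>

locale left_module = R?: ring R + M?: abelian_group M
  for R (structure) and M (structure) +
  assumes smult_closed [simp, intro]:
      "\<lbrakk>a \<in> carrier R; x \<in> carrier M\<rbrakk> \<Longrightarrow> a \<odot>\<^bsub>M\<^esub> x \<in> carrier M"
    and smult_l_distr:
      "\<lbrakk>a \<in> carrier R; b \<in> carrier R; x \<in> carrier M\<rbrakk> \<Longrightarrow>
       (a \<oplus>\<^bsub>R\<^esub> b) \<odot>\<^bsub>M\<^esub> x = a \<odot>\<^bsub>M\<^esub> x \<oplus>\<^bsub>M\<^esub> b \<odot>\<^bsub>M\<^esub> x"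
    and smult_r_distr:
      "\<lbrakk>a \<in> carrier R; x \<in> carrier M; y \<in> carrier M\<rbrakk> \<Longrightarrow>
       a \<odot>\<^bsub>M\<^esub> (x \<oplus>\<^bsub>M\<^esub> y) = a \<odot>\<^bsub>M\<^esub> x \<oplus>\<^bsub>M\<^esub> a \<odot>\<^bsub>M\<^esub> y"
    and smult_assoc1:
      "\<lbrakk>a \<in> carrier R; b \<in> carrier R; x \<in> carrier M\<rbrakk> \<Longrightarrow>
       (a \<otimes>\<^bsub>R\<^esub> b) \<odot>\<^bsub>M\<^esub> x = a \<odot>\<^bsub>M\<^esub> (b \<odot>\<^bsub>M\<^esub> x)"
    and smult_one [simp]:
      "x \<in> carrier M \<Longrightarrow> \<one>\<^bsub>R\<^esub> \<odot>\<^bsub>M\<^esub> x = x"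

text \<open>Prime rings are non-zero by convention.\<close>

locale prime_ring = ring R for R (structure) +
  assumes one_not_zero: "\<one> \<noteq> \<zero>"
    and prime: "\<lbrakk>ideal I R; ideal J R; I \<cdot> J = {\<zero>}\<rbrakk> \<Longrightarrow> I = {\<zero>} \<or> J = {\<zero>}"

definition left_regular :: "('r, 'a) ring_scheme \<Rightarrow> ('r, 'r) module" where
  "left_regular R = \<lparr>carrier = carrier R, mult = mult R, one = one R,
     zero = zero R, add = add R, smult = mult R\<rparr>"

definition left_ideal :: "'r set \<Rightarrow> ('r, 'a) ring_scheme \<Rightarrow> bool" where
  "left_ideal I R \<longleftrightarrow> submodule I R (left_regular R)"

definition left_duo :: "('r, 'a) ring_scheme \<Rightarrow> bool" where
  "left_duo R \<longleftrightarrow> (\<forall>I. left_ideal I R \<longrightarrow> ideal I R)"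

definition faithful :: "('r, 'a) ring_scheme \<Rightarrow> ('r, 'm, 'b) module_scheme \<Rightarrow> bool" where
  "faithful R M \<longleftrightarrow> {r \<in> carrier R. \<forall>x \<in> carrier M. r \<odot>\<^bsub>M\<^esub> x = \<zero>\<^bsub>M\<^esub>} = {\<zero>\<^bsub>R\<^esub>}"

text \<open>Homomorphisms are extensional, so that two of them are equal iff they agree on the carrier.\<close>

definition mod_hom ::
  "('r, 'a) ring_scheme \<Rightarrow> ('r, 'm, 'b) module_scheme \<Rightarrow> ('r, 'n, 'c) module_scheme
     \<Rightarrow> ('m \<Rightarrow> 'n) set" where
  "mod_hom R M N = {f \<in> carrier M \<rightarrow>\<^sub>E carrier N.
     (\<forall>x \<in> carrier M. \<forall>y \<in> carrier M. f (x \<oplus>\<^bsub>M\<^esub> y) = f x \<oplus>\<^bsub>N\<^esub> f y) \<and>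
     (\<forall>r \<in> carrier R. \<forall>x \<in> carrier M. f (r \<odot>\<^bsub>M\<^esub> x) = r \<odot>\<^bsub>N\<^esub> f x)}"

text \<open>Homomorphisms are written on the right of their arguments, so the product \<open>f g\<close> in the
  endomorphism ring means: first \<open>f\<close>, then \<open>g\<close>.\<close>

definition End_ring ::
  "('r, 'a) ring_scheme \<Rightarrow> ('r, 'm, 'b) module_scheme \<Rightarrow> ('m \<Rightarrow> 'm) ring" where
  "End_ring R M = \<lparr>carrier = mod_hom R M M,
     mult = (\<lambda>f g. compose (carrier M) g f),
     one = (\<lambda>x \<in> carrier M. x),
     zero = (\<lambda>x \<in> carrier M. \<zero>\<^bsub>M\<^esub>),
     add = (\<lambda>f g. \<lambda>x \<in> carrier M. f x \<oplus>\<^bsub>M\<^esub> g x)\<rparr>"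

text \<open>\<open>N * L\<close> is the sum of the submodules \<open>(N)f\<close>, where \<open>f\<close> ranges over the homomorphisms
  from \<open>M\<close> to \<open>L\<close>.\<close>

definition star ::
  "('r, 'a) ring_scheme \<Rightarrow> ('r, 'm, 'b) module_scheme \<Rightarrow> 'm set \<Rightarrow> 'm set \<Rightarrow> 'm set" where
  "star R M N L = {finsum M s F | s F.
     finite F \<and> F \<subseteq> mod_hom R M (M\<lparr>carrier := L\<rparr>) \<and> (\<forall>f \<in> F. s f \<in> f ` N)}"

definition star_prime :: "('r, 'a) ring_scheme \<Rightarrow> ('r, 'm, 'b) module_scheme \<Rightarrow> bool" where
  "star_prime R M \<longleftrightarrow> (\<forall>N L. submodule N R M \<longrightarrow> submodule L R M \<longrightarrow>
     N \<noteq> {\<zero>\<^bsub>M\<^esub>} \<longrightarrow> L \<noteq> {\<zero>\<^bsub>M\<^esub>} \<longrightarrow> star R M N L \<noteq> {\<zero>\<^bsub>M\<^esub>})"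

definition direct_power :: "'i set \<Rightarrow> ('r, 'u, 'c) module_scheme \<Rightarrow> ('r, 'i \<Rightarrow> 'u) module" where
  "direct_power I U = \<lparr>carrier = I \<rightarrow>\<^sub>E carrier U,
     mult = (\<lambda>x y. \<lambda>i \<in> I. x i \<otimes>\<^bsub>U\<^esub> y i),
     one = (\<lambda>i \<in> I. \<one>\<^bsub>U\<^esub>),
     zero = (\<lambda>i \<in> I. \<zero>\<^bsub>U\<^esub>),
     add = (\<lambda>x y. \<lambda>i \<in> I. x i \<oplus>\<^bsub>U\<^esub> y i),
     smult = (\<lambda>r x. \<lambda>i \<in> I. r \<odot>\<^bsub>U\<^esub> x i)\<rparr>"

text \<open>HOL cannot quantify over the type of the index set inside a definition. Index sets contained
  in \<open>'m \<Rightarrow> 'u\<close> suffice: by the lemma \<open>cogenerated_byI\<close> below, an embedding into a direct power with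
  an index set of any type yields one of this form.\<close>

definition cogenerated_by ::
  "('r, 'a) ring_scheme \<Rightarrow> ('r, 'm, 'b) module_scheme \<Rightarrow> ('r, 'u, 'c) module_scheme \<Rightarrow> bool" where
  "cogenerated_by R M U \<longleftrightarrow> (\<exists>(I :: ('m \<Rightarrow> 'u) set) \<phi>.
     \<phi> \<in> mod_hom R M (direct_power I U) \<and> inj_on \<phi> (carrier M))"

lemma cogenerated_byI:
  fixes I :: "'i set"
  assumes M: "left_module R M"
    and \<phi>: "\<phi> \<in> mod_hom R M (direct_power I U)"
    and inj: "inj_on \<phi> (carrier M)"
  shows "cogenerated_by R M U"
proof -
  interpret left_module R M by (rule M)
  define H where "H = mod_hom R M U"
  define \<psi> where "\<psi> = (\<lambda>x \<in> carrier M. \<lambda>f \<in> H. f x)"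
  have hom: "(\<lambda>x \<in> carrier M. \<phi> x i) \<in> H" if "i \<in> I" for i
    using \<phi> that unfolding H_def mod_hom_def direct_power_def by (auto simp: PiE_iff Pi_iff)
  have "\<psi> \<in> mod_hom R M (direct_power H U)"
    unfolding \<psi>_def mod_hom_def direct_power_def
    by (auto simp: H_def mod_hom_def PiE_iff Pi_iff intro!: restrict_ext)
  moreover have "inj_on \<psi> (carrier M)"
  proof (rule inj_onI)
    fix x y assume x: "x \<in> carrier M" and y: "y \<in> carrier M" and eq: "\<psi> x = \<psi> y"
    have f_eq: "f x = f y" if "f \<in> H" for f
      using fun_cong[OF eq, of f] that x y by (simp add: \<psi>_def)
    have "\<phi> x i = \<phi> y i" if "i \<in> I" for i
      using f_eq[OF hom[OF that]] x y by simp
    moreover have "\<phi> x \<in> I \<rightarrow>\<^sub>E carrier U" "\<phi> y \<in> I \<rightarrow>\<^sub>E carrier U"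
      using \<phi> x y by (auto simp: mod_hom_def direct_power_def)
    ultimately have "\<phi> x = \<phi> y" by (metis PiE_ext)
    then show "x = y" using inj x y by (auto dest: inj_onD)
  qed
  ultimately show ?thesis unfolding cogenerated_by_def by blast
qed

definition torsionless :: "('r, 'a) ring_scheme \<Rightarrow> ('r, 'm, 'b) module_scheme \<Rightarrow> bool" where
  "torsionless R M \<longleftrightarrow> cogenerated_by R M (left_regular R)"

definition essential_submodule ::
  "('r, 'a) ring_scheme \<Rightarrow> ('r, 'm, 'b) module_scheme \<Rightarrow> 'm set \<Rightarrow> bool" where
  "essential_submodule R M E \<longleftrightarrow> submodule E R M \<and>
     (\<forall>N. submodule N R M \<longrightarrow> N \<noteq> {\<zero>\<^bsub>M\<^esub>} \<longrightarrow> E \<inter> N \<noteq> {\<zero>\<^bsub>M\<^esub>})"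

definition annihilator ::
  "('r, 'a) ring_scheme \<Rightarrow> ('r, 'm, 'b) module_scheme \<Rightarrow> 'm \<Rightarrow> 'r set" where
  "annihilator R M x = {r \<in> carrier R. r \<odot>\<^bsub>M\<^esub> x = \<zero>\<^bsub>M\<^esub>}"

definition singular_elements ::
  "('r, 'a) ring_scheme \<Rightarrow> ('r, 'm, 'b) module_scheme \<Rightarrow> 'm set" where
  "singular_elements R M =
     {x \<in> carrier M. essential_submodule R (left_regular R) (annihilator R M x)}"

definition singular :: "('r, 'a) ring_scheme \<Rightarrow> ('r, 'm, 'b) module_scheme \<Rightarrow> bool" where
  "singular R M \<longleftrightarrow> singular_elements R M = carrier M"

definition nonsingular :: "('r, 'a) ring_scheme \<Rightarrow> ('r, 'm, 'b) module_scheme \<Rightarrow> bool" where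
  "nonsingular R M \<longleftrightarrow> singular_elements R M = {\<zero>\<^bsub>M\<^esub>}"

end

theory Submission
  imports Defs
begin

text \<open>\<open>M\<close> is torsionless iff the homomorphisms from \<open>M\<close> to \<open>R\<close> separate the points of \<open>M\<close>. A
  non-singular element \<open>m\<close> yields a non-zero left ideal \<open>K\<close> that meets the annihilator of \<open>m\<close> in
  \<open>0\<close>, so \<open>Km\<close> is a submodule of \<open>M\<close> that embeds in \<open>R\<close>. If \<open>M\<close> is \<open>*\<close>-prime, then every non-zero
  element is mapped to a non-zero one by some homomorphism from \<open>M\<close> to \<open>Km\<close>. Over a left duo
  ring, the annihilator of \<open>m \<noteq> 0\<close> is two-sided, hence it annihilates everything that is cogenerated
  by \<open>Rm\<close>, in particular \<open>M\<close>; so it is \<open>0\<close>. In the third case, Zorn's lemma provides an essential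
  submodule of \<open>M\<close> that is torsionless. Finally, given non-zero endomorphisms \<open>f\<close> and \<open>g\<close> of a
  torsionless \<open>M\<close>, suitable \<open>\<phi> : M \<rightarrow> R\<close>, \<open>a \<in> R\<close> and \<open>x \<in> M\<close> make \<open>f h g \<noteq> 0\<close> for
  \<open>h : y \<mapsto> (y \<phi>) a x\<close>.\<close>

section \<open>Submodules and the regular module\<close>

lemma (in abelian_group) eq_if_minus_zero:
  assumes "x \<ominus> y = \<zero>" "x \<in> carrier G" "y \<in> carrier G"
  shows "x = y"
  using assms by (metis a_inv_closed minus_equality minus_minus a_minus_def)

context left_module
begin

lemma smult_l_null [simp]: "x \<in> carrier M \<Longrightarrow> \<zero>\<^bsub>R\<^esub> \<odot>\<^bsub>M\<^esub> x = \<zero>\<^bsub>M\<^esub>"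
  by (metis M.add.r_cancel_one' R.l_zero R.zero_closed smult_closed smult_l_distr)

lemma smult_r_null [simp]: "a \<in> carrier R \<Longrightarrow> a \<odot>\<^bsub>M\<^esub> \<zero>\<^bsub>M\<^esub> = \<zero>\<^bsub>M\<^esub>"
  by (metis M.add.r_cancel_one' M.l_zero M.zero_closed smult_closed smult_r_distr)

lemma smult_minus_one: "x \<in> carrier M \<Longrightarrow> (\<ominus>\<^bsub>R\<^esub> \<one>\<^bsub>R\<^esub>) \<odot>\<^bsub>M\<^esub> x = \<ominus>\<^bsub>M\<^esub> x"
  by (metis M.minus_equality R.add.inv_closed R.l_neg R.one_closed smult_closed smult_l_distr
      smult_l_null smult_one)

text \<open>Closure under negation comes for free from closure under scalars, since the negative of
  \<open>x\<close> is (-1)x.\<close>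

lemma submoduleI:
  assumes sub: "H \<subseteq> carrier M" and zero: "\<zero>\<^bsub>M\<^esub> \<in> H"
    and add: "\<And>x y. \<lbrakk>x \<in> H; y \<in> H\<rbrakk> \<Longrightarrow> x \<oplus>\<^bsub>M\<^esub> y \<in> H"
    and smult: "\<And>a x. \<lbrakk>a \<in> carrier R; x \<in> H\<rbrakk> \<Longrightarrow> a \<odot>\<^bsub>M\<^esub> x \<in> H"
  shows "submodule H R M"
proof -
  have "\<ominus>\<^bsub>M\<^esub> x \<in> H" if "x \<in> H" for x
    using smult[of "\<ominus>\<^bsub>R\<^esub> \<one>\<^bsub>R\<^esub>" x] smult_minus_one[of x] that sub by auto
  then show ?thesis
    using assms by unfold_locales (auto simp: a_inv_def)
qed

lemma submoduleD:
  assumes "submodule H R M"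
  shows "H \<subseteq> carrier M" "\<zero>\<^bsub>M\<^esub> \<in> H"
    and "\<And>x y. \<lbrakk>x \<in> H; y \<in> H\<rbrakk> \<Longrightarrow> x \<oplus>\<^bsub>M\<^esub> y \<in> H"
    and "\<And>a x. \<lbrakk>a \<in> carrier R; x \<in> H\<rbrakk> \<Longrightarrow> a \<odot>\<^bsub>M\<^esub> x \<in> H"
proof -
  interpret submodule H R M by fact
  show "H \<subseteq> carrier M" "\<zero>\<^bsub>M\<^esub> \<in> H"
    and "\<And>x y. \<lbrakk>x \<in> H; y \<in> H\<rbrakk> \<Longrightarrow> x \<oplus>\<^bsub>M\<^esub> y \<in> H"
    and "\<And>a x. \<lbrakk>a \<in> carrier R; x \<in> H\<rbrakk> \<Longrightarrow> a \<odot>\<^bsub>M\<^esub> x \<in> H"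
    using subset one_closed m_closed smult_closed by auto
qed

text \<open>This makes results about homomorphisms between modules available for maps into or out of
  a submodule, such as those in \<open>star\<close> or in cogeneration by an essential
  submodule.\<close>

lemma left_module_submodule:
  assumes "submodule H R M"
  shows "left_module R (M\<lparr>carrier := H\<rparr>)"
proof -
  note H = submoduleD[OF assms]
  have "\<exists>y\<in>H. y \<oplus>\<^bsub>M\<^esub> x = \<zero>\<^bsub>M\<^esub>" if "x \<in> H" for x
    using H(4)[of "\<ominus>\<^bsub>R\<^esub> \<one>\<^bsub>R\<^esub>" x] that H(1) by (auto simp: smult_minus_one M.l_neg intro!: bexI)
  then have "abelian_group (M\<lparr>carrier := H\<rparr>)"
    using H by (intro abelian_groupI) (auto simp: M.a_ac subset_iff)
  then show ?thesis
    using H by (intro left_module.intro left_module_axioms.intro R.ring_axioms)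
      (auto simp: smult_l_distr smult_r_distr smult_assoc1 subset_iff)
qed

end

lemma left_regular_simps [simp]:
  "carrier (left_regular R) = carrier R"
  "zero (left_regular R) = zero R"
  "add (left_regular R) = add R"
  "smult (left_regular R) = mult R"
  by (simp_all add: left_regular_def)

lemma (in ring) left_module_left_regular: "left_module R (left_regular R)"
proof -
  have "abelian_group (left_regular R)"
    by (rule abelian_groupI) (auto simp: a_ac intro: l_neg)
  then show ?thesis
    by (intro left_module.intro left_module_axioms.intro ring_axioms)
      (auto simp: l_distr r_distr m_assoc)
qed

lemma (in left_module) submodule_image_left_ideal:
  assumes x: "x \<in> carrier M" and I: "left_ideal I R"
  shows "submodule ((\<lambda>r. r \<odot>\<^bsub>M\<^esub> x) ` I) R M"
proof -
  note I' = left_module.submoduleD[OF R.left_module_left_regular I[unfolded left_ideal_def], simplified]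
  show ?thesis
  proof (rule submoduleI)
    show "\<zero>\<^bsub>M\<^esub> \<in> (\<lambda>r. r \<odot>\<^bsub>M\<^esub> x) ` I"
      using x I'(2) by (force intro!: image_eqI[where x = "\<zero>\<^bsub>R\<^esub>"])
  next
    fix y z assume "y \<in> (\<lambda>r. r \<odot>\<^bsub>M\<^esub> x) ` I" "z \<in> (\<lambda>r. r \<odot>\<^bsub>M\<^esub> x) ` I"
    then obtain r s where "r \<in> I" "s \<in> I" "y = r \<odot>\<^bsub>M\<^esub> x" "z = s \<odot>\<^bsub>M\<^esub> x" by blast
    then show "y \<oplus>\<^bsub>M\<^esub> z \<in> (\<lambda>r. r \<odot>\<^bsub>M\<^esub> x) ` I"
      using x I' by (auto intro!: image_eqI[where x = "r \<oplus>\<^bsub>R\<^esub> s"] simp: smult_l_distr subset_iff)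
  next
    fix a y assume "a \<in> carrier R" "y \<in> (\<lambda>r. r \<odot>\<^bsub>M\<^esub> x) ` I"
    then obtain r where "r \<in> I" "y = r \<odot>\<^bsub>M\<^esub> x" "a \<in> carrier R" by blast
    then show "a \<odot>\<^bsub>M\<^esub> y \<in> (\<lambda>r. r \<odot>\<^bsub>M\<^esub> x) ` I"
      using x I' by (auto intro!: image_eqI[where x = "a \<otimes>\<^bsub>R\<^esub> r"] simp: smult_assoc1 subset_iff)
  qed (use x I' in auto)
qed

lemma (in ring) left_ideal_carrier: "left_ideal (carrier R) R"
  unfolding left_ideal_def by (rule left_module.submoduleI[OF left_module_left_regular]) auto

lemma (in left_module) submodule_cyclic:
  assumes "x \<in> carrier M"
  shows "submodule ((\<lambda>r. r \<odot>\<^bsub>M\<^esub> x) ` carrier R) R M"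
  by (rule submodule_image_left_ideal[OF assms R.left_ideal_carrier])

lemma (in left_module) cyclic_nonzero:
  assumes "x \<in> carrier M" "x \<noteq> \<zero>\<^bsub>M\<^esub>"
  shows "(\<lambda>r. r \<odot>\<^bsub>M\<^esub> x) ` carrier R \<noteq> {\<zero>\<^bsub>M\<^esub>}"
  using assms smult_one R.one_closed by (metis imageI singletonD)

section \<open>Homomorphisms and cogeneration\<close>

lemma mod_homI:
  assumes "f \<in> extensional (carrier M)"
    and "\<And>x. x \<in> carrier M \<Longrightarrow> f x \<in> carrier N"
    and "\<And>x y. \<lbrakk>x \<in> carrier M; y \<in> carrier M\<rbrakk> \<Longrightarrow> f (x \<oplus>\<^bsub>M\<^esub> y) = f x \<oplus>\<^bsub>N\<^esub> f y"
    and "\<And>r x. \<lbrakk>r \<in> carrier R; x \<in> carrier M\<rbrakk> \<Longrightarrow> f (r \<odot>\<^bsub>M\<^esub> x) = r \<odot>\<^bsub>N\<^esub> f x"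
  shows "f \<in> mod_hom R M N"
  using assms by (auto simp: mod_hom_def PiE_def)

lemma mod_homD:
  assumes "f \<in> mod_hom R M N"
  shows "f \<in> extensional (carrier M)"
    and "\<And>x. x \<in> carrier M \<Longrightarrow> f x \<in> carrier N"
    and "\<And>x y. \<lbrakk>x \<in> carrier M; y \<in> carrier M\<rbrakk> \<Longrightarrow> f (x \<oplus>\<^bsub>M\<^esub> y) = f x \<oplus>\<^bsub>N\<^esub> f y"
    and "\<And>r x. \<lbrakk>r \<in> carrier R; x \<in> carrier M\<rbrakk> \<Longrightarrow> f (r \<odot>\<^bsub>M\<^esub> x) = r \<odot>\<^bsub>N\<^esub> f x"
  using assms by (auto simp: mod_hom_def PiE_def)

lemma mod_hom_zero:
  assumes "left_module R M" "left_module R N" and f: "f \<in> mod_hom R M N"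
  shows "f \<zero>\<^bsub>M\<^esub> = \<zero>\<^bsub>N\<^esub>"
proof -
  interpret M: left_module R M by fact
  interpret N: left_module R N by fact
  have "f \<zero>\<^bsub>M\<^esub> = f (\<zero>\<^bsub>R\<^esub> \<odot>\<^bsub>M\<^esub> \<zero>\<^bsub>M\<^esub>)" by simp
  also have "\<dots> = \<zero>\<^bsub>R\<^esub> \<odot>\<^bsub>N\<^esub> f \<zero>\<^bsub>M\<^esub>" by (rule mod_homD(4)[OF f]) auto
  also have "\<dots> = \<zero>\<^bsub>N\<^esub>" using mod_homD(2)[OF f] by auto
  finally show ?thesis .
qed

lemma mod_hom_compose:
  assumes M: "left_module R M" and f: "f \<in> mod_hom R M N" and g: "g \<in> mod_hom R N P"
  shows "compose (carrier M) g f \<in> mod_hom R M P"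
proof -
  interpret left_module R M by fact
  show ?thesis
    using mod_homD[OF f] mod_homD[OF g] by (intro mod_homI) (auto simp: compose_def)
qed

text \<open>The coordinates of an embedding into a direct power are homomorphisms to
  \<open>U\<close> that vanish simultaneously only at zero. Conversely, evaluation at all
  homomorphisms maps \<open>M\<close> to the power indexed by \<open>mod_hom R M U\<close>; it is
  injective because the separation property can be applied to a difference
  \<open>x - y\<close>.\<close>

lemma cogenerated_by_iff:
  fixes M :: "('r, 'm, 'b) module_scheme" and U :: "('r, 'u, 'c) module_scheme"
  assumes M: "left_module R M" and U: "left_module R U"
  shows "cogenerated_by R M U \<longleftrightarrow>
    (\<forall>x \<in> carrier M. x \<noteq> \<zero>\<^bsub>M\<^esub> \<longrightarrow> (\<exists>f \<in> mod_hom R M U. f x \<noteq> \<zero>\<^bsub>U\<^esub>))"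
proof -
  interpret M: left_module R M by fact
  interpret U: left_module R U by fact
  show ?thesis
  proof
    assume "cogenerated_by R M U"
    then obtain I :: "('m \<Rightarrow> 'u) set" and \<phi>
      where \<phi>: "\<phi> \<in> mod_hom R M (direct_power I U)" and inj: "inj_on \<phi> (carrier M)"
      unfolding cogenerated_by_def by blast
    have coord: "(\<lambda>x \<in> carrier M. \<phi> x i) \<in> mod_hom R M U" if "i \<in> I" for i
      using mod_homD[OF \<phi>] that by (intro mod_homI) (auto simp: direct_power_def PiE_iff)
    have "\<phi> x = \<phi> \<zero>\<^bsub>M\<^esub>"
      if x: "x \<in> carrier M" and "\<forall>f \<in> mod_hom R M U. f x = \<zero>\<^bsub>U\<^esub>" for x
    proof (rule PiE_ext)
      show "\<phi> x \<in> I \<rightarrow>\<^sub>E carrier U" "\<phi> \<zero>\<^bsub>M\<^esub> \<in> I \<rightarrow>\<^sub>E carrier U"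
        using mod_homD(2)[OF \<phi>] x by (auto simp: direct_power_def)
      show "\<phi> x i = \<phi> \<zero>\<^bsub>M\<^esub> i" if "i \<in> I" for i
        using bspec[OF \<open>\<forall>f \<in> mod_hom R M U. f x = \<zero>\<^bsub>U\<^esub>\<close> coord[OF that]]
          mod_hom_zero[OF M U coord[OF that]] x by simp
    qed
    then show "\<forall>x \<in> carrier M. x \<noteq> \<zero>\<^bsub>M\<^esub> \<longrightarrow> (\<exists>f \<in> mod_hom R M U. f x \<noteq> \<zero>\<^bsub>U\<^esub>)"
      using inj by (metis M.M.zero_closed inj_onD)
  next
    assume sep: "\<forall>x \<in> carrier M. x \<noteq> \<zero>\<^bsub>M\<^esub> \<longrightarrow> (\<exists>f \<in> mod_hom R M U. f x \<noteq> \<zero>\<^bsub>U\<^esub>)"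
    define \<phi> where "\<phi> = (\<lambda>x \<in> carrier M. \<lambda>f \<in> mod_hom R M U. f x)"
    have "\<phi> \<in> mod_hom R M (direct_power (mod_hom R M U) U)"
      by (rule mod_homI) (auto simp: \<phi>_def direct_power_def mod_homD intro!: restrict_ext)
    moreover have "inj_on \<phi> (carrier M)"
    proof (rule inj_onI)
      fix x y assume x: "x \<in> carrier M" and y: "y \<in> carrier M" and eq: "\<phi> x = \<phi> y"
      have "f (x \<ominus>\<^bsub>M\<^esub> y) = \<zero>\<^bsub>U\<^esub>" if f: "f \<in> mod_hom R M U" for f
      proof -
        have "f x = f y" using fun_cong[OF eq, of f] x y f by (simp add: \<phi>_def)
        moreover have "f (\<ominus>\<^bsub>M\<^esub> y) = \<ominus>\<^bsub>U\<^esub> f y"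
          using mod_homD[OF f] y M.smult_minus_one[OF y] U.smult_minus_one[of "f y"]
          by (metis M.R.add.inv_closed M.R.one_closed)
        ultimately show ?thesis
          using mod_homD[OF f] x y by (simp add: a_minus_def U.M.r_neg)
      qed
      then have "x \<ominus>\<^bsub>M\<^esub> y = \<zero>\<^bsub>M\<^esub>" using sep x y by auto
      then show "x = y" using x y by (rule M.M.eq_if_minus_zero)
    qed
    ultimately show "cogenerated_by R M U" unfolding cogenerated_by_def by blast
  qed
qed

section \<open>The endomorphism ring\<close>

lemma End_ring_simps [simp]:
  "carrier (End_ring R M) = mod_hom R M M"
  "f \<otimes>\<^bsub>End_ring R M\<^esub> g = compose (carrier M) g f"
  "\<one>\<^bsub>End_ring R M\<^esub> = (\<lambda>x \<in> carrier M. x)"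
  "\<zero>\<^bsub>End_ring R M\<^esub> = (\<lambda>x \<in> carrier M. \<zero>\<^bsub>M\<^esub>)"
  "f \<oplus>\<^bsub>End_ring R M\<^esub> g = (\<lambda>x \<in> carrier M. f x \<oplus>\<^bsub>M\<^esub> g x)"
  by (simp_all add: End_ring_def)

lemma (in left_module) ring_End_ring: "ring (End_ring R M)"
proof (rule ringI)
  note hom = mod_homD[of _ R M M]
  have minus: "(\<lambda>x \<in> carrier M. \<ominus>\<^bsub>M\<^esub> f x) \<in> mod_hom R M M" if f: "f \<in> mod_hom R M M" for f
  proof (rule mod_homI)
    fix r x assume r: "r \<in> carrier R" and x: "x \<in> carrier M"
    \<comment> \<open>Uniqueness of additive inverses turns this equation into r(-f x) = -(r(f
      x)).\<close>
    have "r \<odot>\<^bsub>M\<^esub> (\<ominus>\<^bsub>M\<^esub> f x) \<oplus>\<^bsub>M\<^esub> r \<odot>\<^bsub>M\<^esub> f x = \<zero>\<^bsub>M\<^esub>"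
      using r hom(2)[OF f x] by (simp add: M.l_neg flip: smult_r_distr)
    then show "(\<lambda>x \<in> carrier M. \<ominus>\<^bsub>M\<^esub> f x) (r \<odot>\<^bsub>M\<^esub> x) = r \<odot>\<^bsub>M\<^esub> (\<lambda>x \<in> carrier M. \<ominus>\<^bsub>M\<^esub> f x) x"
      using r x hom[OF f] by (simp add: M.minus_equality)
  qed (use hom[OF f] in \<open>auto simp: M.minus_add\<close>)
  show "abelian_group (End_ring R M)"
  proof (rule abelian_groupI)
    show "f \<oplus>\<^bsub>End_ring R M\<^esub> g \<in> carrier (End_ring R M)"
      if "f \<in> carrier (End_ring R M)" "g \<in> carrier (End_ring R M)" for f g
      using hom[of f] hom[of g] that
      by (auto intro!: mod_homI simp: smult_r_distr M.a_ac)
    show "\<zero>\<^bsub>End_ring R M\<^esub> \<in> carrier (End_ring R M)"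
      by (auto intro!: mod_homI)
    show "\<exists>g \<in> carrier (End_ring R M). g \<oplus>\<^bsub>End_ring R M\<^esub> f = \<zero>\<^bsub>End_ring R M\<^esub>"
      if "f \<in> carrier (End_ring R M)" for f
      using minus[of f] that hom[of f]
      by (auto intro!: bexI[where x = "\<lambda>x \<in> carrier M. \<ominus>\<^bsub>M\<^esub> f x"] restrict_ext simp: M.l_neg)
  qed (auto simp: hom M.a_ac intro!: restrict_ext extensionalityI[where A = "carrier M"])
  show "monoid (End_ring R M)"
  proof (rule monoidI)
    show "\<one>\<^bsub>End_ring R M\<^esub> \<in> carrier (End_ring R M)"
      by (auto intro!: mod_homI)
  qed (auto simp: hom mod_hom_compose[OF left_module_axioms, unfolded compose_def]
      compose_def
      intro!: extensionalityI[where A = "carrier M"])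
qed (auto simp: mod_homD[of _ R M M] compose_def intro!: restrict_ext)

section \<open>Primeness in terms of elements\<close>

text \<open>If r R s = 0, then \<open>r\<close> lies in the left annihilator \<open>I\<close> of R
  s, and \<open>s\<close> lies in the right annihilator \<open>J\<close> of \<open>I\<close>. Both
  are two-sided ideals and their product is zero, so primeness makes one of them zero, against
  \<open>r\<close> and \<open>s\<close> being non-zero.\<close>

lemma (in prime_ring) prime_elements:
  assumes r: "r \<in> carrier R" "r \<noteq> \<zero>" and s: "s \<in> carrier R" "s \<noteq> \<zero>"
  shows "\<exists>a \<in> carrier R. r \<otimes> a \<otimes> s \<noteq> \<zero>"
proof (rule ccontr)
  assume "\<not> ?thesis"
  then have rs: "\<And>a. a \<in> carrier R \<Longrightarrow> r \<otimes> a \<otimes> s = \<zero>" by blast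
  define I where "I = {x \<in> carrier R. \<forall>a \<in> carrier R. x \<otimes> a \<otimes> s = \<zero>}"
  define J where "J = {y \<in> carrier R. \<forall>x \<in> I. x \<otimes> y = \<zero>}"
  have I: "ideal I R"
  proof (rule idealI[OF ring_axioms])
    show "subgroup I (add_monoid R)"
      using s by (intro add.subgroupI)
        (auto simp: I_def l_distr l_minus simp flip: a_inv_def intro!: exI[where x = \<zero>])
    show "y \<otimes> x \<in> I" if "x \<in> I" "y \<in> carrier R" for x y
      using that s by (auto simp: I_def m_assoc)
    show "x \<otimes> y \<in> I" if "x \<in> I" "y \<in> carrier R" for x y
    proof -
      \<comment> \<open>The factor \<open>y\<close> is absorbed into the arbitrary middle factor of
        the condition that defines \<open>I\<close>.\<close>
      have "x \<otimes> (y \<otimes> a) \<otimes> s = \<zero>" if "a \<in> carrier R" for a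
        using that \<open>x \<in> I\<close> \<open>y \<in> carrier R\<close> unfolding I_def by blast
      then show ?thesis using that by (auto simp: I_def m_assoc)
    qed
  qed
  have Icarr: "x \<in> carrier R" if "x \<in> I" for x using that by (simp add: I_def)
  have J: "ideal J R"
  proof (rule idealI[OF ring_axioms])
    show "subgroup J (add_monoid R)"
      by (rule add.subgroupI) (auto simp: J_def r_distr r_minus Icarr simp flip: a_inv_def)
    show "x \<otimes> y \<in> J" if "y \<in> J" "x \<in> carrier R" for x y
    proof -
      have "z \<otimes> (x \<otimes> y) = \<zero>" if "z \<in> I" for z
        using ideal.I_r_closed[OF I that \<open>x \<in> carrier R\<close>] \<open>y \<in> J\<close> \<open>x \<in> carrier R\<close> Icarr[OF that]
        unfolding J_def by (auto simp flip: m_assoc)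
      then show ?thesis using that by (auto simp: J_def)
    qed
    show "y \<otimes> x \<in> J" if "y \<in> J" "x \<in> carrier R" for x y
      using that by (auto simp: J_def Icarr simp flip: m_assoc)
  qed
  have "x = \<zero>" if "x \<in> I \<cdot> J" for x
    using that by (induction rule: ideal_prod.induct) (auto simp: J_def)
  moreover have "\<zero> \<in> I \<cdot> J"
    using ideal_prod.prod[of \<zero> I \<zero> J R] additive_subgroup.zero_closed[of _ R]
      ideal.axioms(1)[OF I] ideal.axioms(1)[OF J] by simp
  ultimately have "I \<cdot> J = {\<zero>}" by blast
  moreover have "r \<in> I" using r rs by (simp add: I_def)
  moreover have "s \<in> J"
    using s by (auto simp: J_def) (auto simp: I_def dest: bspec[of _ _ \<one>])
  ultimately show False using prime[OF I J] r s by blast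
qed

section \<open>Torsionless modules and primeness of their endomorphism rings\<close>

lemma torsionless_iff:
  assumes "left_module R M"
  shows "torsionless R M \<longleftrightarrow> (\<forall>x \<in> carrier M. x \<noteq> \<zero>\<^bsub>M\<^esub> \<longrightarrow>
    (\<exists>f \<in> mod_hom R M (left_regular R). f x \<noteq> \<zero>\<^bsub>R\<^esub>))"
proof -
  interpret left_module R M by fact
  show ?thesis
    unfolding torsionless_def
    using cogenerated_by_iff[OF assms R.left_module_left_regular] by simp
qed

text \<open>On the zero module the ring unit acts as zero, so faithfulness would force 1 =
  0.\<close>

lemma exists_nonzero_if_faithful:
  assumes "prime_ring R" "left_module R M" "faithful R M"
  shows "\<exists>x \<in> carrier M. x \<noteq> \<zero>\<^bsub>M\<^esub>"
proof (rule ccontr)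
  assume *: "\<not> ?thesis"
  interpret prime_ring R by fact
  interpret M: left_module R M by fact
  have "\<one>\<^bsub>R\<^esub> \<odot>\<^bsub>M\<^esub> x = \<zero>\<^bsub>M\<^esub>" if "x \<in> carrier M" for x using * that by auto
  then have "\<one>\<^bsub>R\<^esub> \<in> {\<zero>\<^bsub>R\<^esub>}" using assms(3) unfolding faithful_def by blast
  then show False using one_not_zero by simp
qed

text \<open>Homomorphisms to \<open>R\<close> turn non-zero values of \<open>f\<close> and
  \<open>g\<close> into non-zero ring elements, between which primeness of \<open>R\<close> supplies
  a factor \<open>a\<close>. An endomorphism \<open>h\<close> built from \<open>a\<close> transports
  the resulting non-zero product back to \<open>M\<close>. The elementwise statement then passes to
  ideals.\<close>

lemma prime_End_ring_if_torsionless: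
  assumes "prime_ring R" "left_module R M" "faithful R M" "torsionless R M"
  shows "prime_ring (End_ring R M)"
proof -
  interpret R: prime_ring R by fact
  interpret M: left_module R M by fact
  let ?E = "End_ring R M"
  interpret E: ring ?E by (rule M.ring_End_ring)
  have sep: "\<exists>f \<in> mod_hom R M (left_regular R). f x \<noteq> \<zero>\<^bsub>R\<^esub>"
    if "x \<in> carrier M" "x \<noteq> \<zero>\<^bsub>M\<^esub>" for x
    using torsionless_iff[OF assms(2)] assms(4) that by blast
  have nonzero: "\<exists>x \<in> carrier M. f x \<noteq> \<zero>\<^bsub>M\<^esub>"
    if "f \<in> mod_hom R M M" "f \<noteq> \<zero>\<^bsub>?E\<^esub>" for f
    using that mod_homD(1)[OF that(1)]
    by (metis End_ring_simps(4) extensionalityI restrict_apply' restrict_extensional)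
  have prime: "\<exists>h \<in> mod_hom R M M. (f \<otimes>\<^bsub>?E\<^esub> h) \<otimes>\<^bsub>?E\<^esub> g \<noteq> \<zero>\<^bsub>?E\<^esub>"
    if f: "f \<in> mod_hom R M M" "f \<noteq> \<zero>\<^bsub>?E\<^esub>" and g: "g \<in> mod_hom R M M" "g \<noteq> \<zero>\<^bsub>?E\<^esub>" for f g
  proof -
    obtain m where m: "m \<in> carrier M" "f m \<noteq> \<zero>\<^bsub>M\<^esub>" using nonzero[OF f] by blast
    obtain x where x: "x \<in> carrier M" "g x \<noteq> \<zero>\<^bsub>M\<^esub>" using nonzero[OF g] by blast
    obtain \<phi> where \<phi>: "\<phi> \<in> mod_hom R M (left_regular R)" "\<phi> (f m) \<noteq> \<zero>\<^bsub>R\<^esub>"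
      using sep[of "f m"] m mod_homD(2)[OF f(1)] by blast
    obtain \<psi> where \<psi>: "\<psi> \<in> mod_hom R M (left_regular R)" "\<psi> (g x) \<noteq> \<zero>\<^bsub>R\<^esub>"
      using sep[of "g x"] x mod_homD(2)[OF g(1)] by blast
    note \<phi>' = mod_homD[OF \<phi>(1), simplified] and \<psi>' = mod_homD[OF \<psi>(1), simplified]
    have fm: "f m \<in> carrier M" and gx: "g x \<in> carrier M"
      using m x mod_homD(2)[OF f(1)] mod_homD(2)[OF g(1)] by auto
    obtain a where a: "a \<in> carrier R" "\<phi> (f m) \<otimes>\<^bsub>R\<^esub> a \<otimes>\<^bsub>R\<^esub> \<psi> (g x) \<noteq> \<zero>\<^bsub>R\<^esub>"
      using R.prime_elements \<phi>(2) \<psi>(2) \<phi>'(2)[OF fm] \<psi>'(2)[OF gx] by blast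
    \<comment> \<open>This endomorphism factors through \<open>R\<close> and has its image in R x:
      it sends \<open>f m\<close> to a multiple of \<open>x\<close>, so that applying
      \<open>g\<close> and then \<open>\<psi>\<close> gives exactly the non-zero product
      above.\<close>
    define h where "h = (\<lambda>y \<in> carrier M. (\<phi> y \<otimes>\<^bsub>R\<^esub> a) \<odot>\<^bsub>M\<^esub> x)"
    have h: "h \<in> mod_hom R M M"
      unfolding h_def using a(1) x(1) \<phi>'
      by (intro mod_homI) (auto simp: R.l_distr M.smult_l_distr R.m_assoc M.smult_assoc1)
    have "\<psi> (g (h (f m))) = \<phi> (f m) \<otimes>\<^bsub>R\<^esub> a \<otimes>\<^bsub>R\<^esub> \<psi> (g x)"
      using a(1) x(1) gx fm \<phi>'(2)[OF fm] \<psi>'(4) mod_homD(4)[OF g(1)] by (simp add: h_def)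
    then have "g (h (f m)) \<noteq> \<zero>\<^bsub>M\<^esub>"
      using a(2) mod_hom_zero[OF assms(2) R.left_module_left_regular \<psi>(1)] by auto
    then have "((f \<otimes>\<^bsub>?E\<^esub> h) \<otimes>\<^bsub>?E\<^esub> g) m \<noteq> \<zero>\<^bsub>?E\<^esub> m"
      using m(1) by (simp add: compose_def)
    then show ?thesis using h by metis
  qed
  show ?thesis
  proof (intro prime_ring.intro prime_ring_axioms.intro M.ring_End_ring)
    \<comment> \<open>A non-zero element of \<open>M\<close> distinguishes the identity from the
      zero map.\<close>
    obtain x where x: "x \<in> carrier M" "x \<noteq> \<zero>\<^bsub>M\<^esub>"
      using exists_nonzero_if_faithful[OF assms(1-3)] by blast
    then have "\<one>\<^bsub>?E\<^esub> x \<noteq> \<zero>\<^bsub>?E\<^esub> x" by simp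
    then show "\<one>\<^bsub>?E\<^esub> \<noteq> \<zero>\<^bsub>?E\<^esub>" by metis
  next
    fix I J assume I: "ideal I ?E" and J: "ideal J ?E" and IJ: "I \<cdot>\<^bsub>?E\<^esub> J = {\<zero>\<^bsub>?E\<^esub>}"
    have "f = \<zero>\<^bsub>?E\<^esub> \<or> g = \<zero>\<^bsub>?E\<^esub>" if f: "f \<in> I" and g: "g \<in> J" for f g
    proof (rule ccontr)
      assume "\<not> ?thesis"
      moreover have "f \<in> mod_hom R M M" "g \<in> mod_hom R M M"
        using ideal.Icarr[OF I f] ideal.Icarr[OF J g] by simp_all
      ultimately obtain h where h: "h \<in> mod_hom R M M" "(f \<otimes>\<^bsub>?E\<^esub> h) \<otimes>\<^bsub>?E\<^esub> g \<noteq> \<zero>\<^bsub>?E\<^esub>"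
        using prime by blast
      \<comment> \<open>As \<open>I\<close> absorbs \<open>h\<close> on the right, the non-zero
        product of \<open>f\<close>, \<open>h\<close> and \<open>g\<close> lies in the product of
        \<open>I\<close> and \<open>J\<close>.\<close>
      have "f \<otimes>\<^bsub>?E\<^esub> h \<in> I" using ideal.I_r_closed[OF I f] h(1) by simp
      then show False using ideal_prod.prod[OF _ g, of _ I ?E] IJ h(2) by blast
    qed
    moreover have "\<zero>\<^bsub>?E\<^esub> \<in> I" "\<zero>\<^bsub>?E\<^esub> \<in> J"
      using additive_subgroup.zero_closed ideal.axioms(1) I J by blast+
    ultimately show "I = {\<zero>\<^bsub>?E\<^esub>} \<or> J = {\<zero>\<^bsub>?E\<^esub>}" by blast
  qed
qed

section \<open>Non-singular elements and embedded left ideals\<close>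

lemma (in left_module) left_ideal_annihilator:
  assumes "x \<in> carrier M"
  shows "left_ideal (annihilator R M x) R"
  unfolding left_ideal_def
  by (rule left_module.submoduleI[OF R.left_module_left_regular])
    (use assms in \<open>auto simp: annihilator_def smult_l_distr smult_assoc1\<close>)

text \<open>The map that sends \<open>r\<close> to \<open>r x\<close> has the annihilator of
  \<open>x\<close> as its kernel. Restricted to a left ideal \<open>K\<close> that meets this kernel
  in zero it is injective, and its inverse embeds K x in \<open>R\<close>.\<close>

lemma (in left_module) exists_embedded_left_ideal:
  assumes x: "x \<in> carrier M" "x \<notin> singular_elements R M"
  shows "\<exists>L g. submodule L R M \<and> L \<subseteq> (\<lambda>r. r \<odot>\<^bsub>M\<^esub> x) ` carrier R \<and> L \<noteq> {\<zero>\<^bsub>M\<^esub>} \<and>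
    g \<in> mod_hom R (M\<lparr>carrier := L\<rparr>) (left_regular R) \<and> inj_on g L"
proof -
  \<comment> \<open>The annihilator is a left ideal; being non-singular, \<open>x\<close> can only
    fail the other half of essentiality.\<close>
  obtain K where K: "left_ideal K R" "K \<noteq> {\<zero>\<^bsub>R\<^esub>}" "annihilator R M x \<inter> K = {\<zero>\<^bsub>R\<^esub>}"
    using x left_ideal_annihilator[OF x(1)]
    by (auto simp: singular_elements_def essential_submodule_def left_ideal_def)
  note K' = left_module.submoduleD[OF R.left_module_left_regular K(1)[unfolded left_ideal_def],
      simplified]
  define L where "L = (\<lambda>r. r \<odot>\<^bsub>M\<^esub> x) ` K"
  have inj: "inj_on (\<lambda>r. r \<odot>\<^bsub>M\<^esub> x) K"
  proof (rule inj_onI)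
    fix r s assume r: "r \<in> K" and s: "s \<in> K" and eq: "r \<odot>\<^bsub>M\<^esub> x = s \<odot>\<^bsub>M\<^esub> x"
    have rs: "r \<in> carrier R" "s \<in> carrier R" using r s K'(1) by auto
    have "\<ominus>\<^bsub>R\<^esub> s = (\<ominus>\<^bsub>R\<^esub> \<one>\<^bsub>R\<^esub>) \<otimes>\<^bsub>R\<^esub> s" using rs by (simp add: R.l_minus)
    then have "r \<ominus>\<^bsub>R\<^esub> s \<in> K"
      using K'(3)[OF r K'(4)[OF _ s, of "\<ominus>\<^bsub>R\<^esub> \<one>\<^bsub>R\<^esub>"]] by (simp add: a_minus_def)
    \<comment> \<open>The term \<open>s x\<close> is added and subtracted; with
      \<open>r x = s x\<close> the right-hand side vanishes.\<close>
    moreover have "(r \<ominus>\<^bsub>R\<^esub> s) \<odot>\<^bsub>M\<^esub> x = (r \<ominus>\<^bsub>R\<^esub> s \<oplus>\<^bsub>R\<^esub> s) \<odot>\<^bsub>M\<^esub> x \<oplus>\<^bsub>M\<^esub> \<ominus>\<^bsub>M\<^esub> (s \<odot>\<^bsub>M\<^esub> x)"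
      using rs x by (simp add: smult_l_distr M.a_assoc M.r_neg)
    then have "(r \<ominus>\<^bsub>R\<^esub> s) \<odot>\<^bsub>M\<^esub> x = \<zero>\<^bsub>M\<^esub>"
      using rs x eq by (simp add: a_minus_def R.a_assoc R.l_neg M.r_neg)
    ultimately have "r \<ominus>\<^bsub>R\<^esub> s \<in> annihilator R M x \<inter> K" using rs by (simp add: annihilator_def)
    then show "r = s" using K(3) rs R.eq_if_minus_zero by blast
  qed
  define g where "g = (\<lambda>y \<in> L. the_inv_into K (\<lambda>r. r \<odot>\<^bsub>M\<^esub> x) y)"
  have gK: "g (r \<odot>\<^bsub>M\<^esub> x) = r" if "r \<in> K" for r
    using that the_inv_into_f_f[OF inj that] by (simp add: g_def L_def)
  have L: "submodule L R M"
    unfolding L_def by (rule submodule_image_left_ideal[OF x(1) K(1)])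
  moreover have "L \<subseteq> (\<lambda>r. r \<odot>\<^bsub>M\<^esub> x) ` carrier R" using K'(1) by (auto simp: L_def)
  moreover have "L \<noteq> {\<zero>\<^bsub>M\<^esub>}"
  proof
    assume "L = {\<zero>\<^bsub>M\<^esub>}"
    then have "K \<subseteq> annihilator R M x" using K'(1) by (auto simp: L_def annihilator_def)
    then show False using K(2,3) by blast
  qed
  moreover have "g \<in> mod_hom R (M\<lparr>carrier := L\<rparr>) (left_regular R)"
  proof (rule mod_homI)
    fix y z assume "y \<in> carrier (M\<lparr>carrier := L\<rparr>)" "z \<in> carrier (M\<lparr>carrier := L\<rparr>)"
    then obtain r s where "r \<in> K" "s \<in> K" "y = r \<odot>\<^bsub>M\<^esub> x" "z = s \<odot>\<^bsub>M\<^esub> x" by (auto simp: L_def)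
    then show "g (y \<oplus>\<^bsub>M\<lparr>carrier := L\<rparr>\<^esub> z) = g y \<oplus>\<^bsub>left_regular R\<^esub> g z"
      using K'(1) K'(3)[of r s] gK[of "r \<oplus>\<^bsub>R\<^esub> s"] x(1) by (simp add: gK smult_l_distr subset_iff)
  next
    fix a y assume "y \<in> carrier (M\<lparr>carrier := L\<rparr>)" and a: "a \<in> carrier R"
    then obtain r where "r \<in> K" "y = r \<odot>\<^bsub>M\<^esub> x" by (auto simp: L_def)
    then show "g (a \<odot>\<^bsub>M\<lparr>carrier := L\<rparr>\<^esub> y) = a \<odot>\<^bsub>left_regular R\<^esub> g y"
      using K'(1) K'(4)[of a r] gK[of "a \<otimes>\<^bsub>R\<^esub> r"] a x(1) by (simp add: gK smult_assoc1 subset_iff)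
  qed (use gK K'(1) in \<open>auto simp: L_def g_def\<close>)
  moreover have "inj_on g L" using gK by (auto simp: L_def inj_on_def)
  ultimately show ?thesis by blast
qed

section \<open>Star-prime modules and the first two cases\<close>

text \<open>If every homomorphism from \<open>M\<close> to \<open>L\<close> kills \<open>N\<close>,
  all summands of the sums in \<open>star R M N L\<close> are zero.\<close>

lemma (in left_module) star_nonzeroD:
  assumes N: "N \<subseteq> carrier M" and ne: "star R M N L \<noteq> {\<zero>\<^bsub>M\<^esub>}"
  shows "\<exists>f \<in> mod_hom R M (M\<lparr>carrier := L\<rparr>). \<exists>n \<in> N. f n \<noteq> \<zero>\<^bsub>M\<^esub>"
proof (rule ccontr)
  assume contra: "\<not> ?thesis"
  have "finsum M s F = \<zero>\<^bsub>M\<^esub>"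
    if F: "F \<subseteq> mod_hom R M (M\<lparr>carrier := L\<rparr>)" "\<forall>f \<in> F. s f \<in> f ` N" for s F
  proof -
    have "s f = \<zero>\<^bsub>M\<^esub>" if "f \<in> F" for f using F contra that by fastforce
    then have "finsum M s F = finsum M (\<lambda>_. \<zero>\<^bsub>M\<^esub>) F" by (intro M.finsum_cong') auto
    then show ?thesis by simp
  qed
  \<comment> \<open>The empty sum ensures that the set contains zero, so it equals the zero
    submodule and is not empty.\<close>
  moreover have "finsum M s {} \<in> star R M N L" for s
    unfolding star_def by (auto intro!: exI[where x = "{}"] exI[where x = s])
  ultimately have "star R M N L = {\<zero>\<^bsub>M\<^esub>}" unfolding star_def by auto
  then show False using ne by simp
qed

text \<open>Star-primeness is applied to the cyclic submodule R x: since f(r x) = r(f x), a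
  homomorphism that does not kill R x does not kill \<open>x\<close>. Hence \<open>M\<close> is
  cogenerated by each of its non-zero submodules.\<close>

lemma (in left_module) star_primeD:
  assumes "star_prime R M" and x: "x \<in> carrier M" "x \<noteq> \<zero>\<^bsub>M\<^esub>"
    and L: "submodule L R M" "L \<noteq> {\<zero>\<^bsub>M\<^esub>}"
  shows "\<exists>f \<in> mod_hom R M (M\<lparr>carrier := L\<rparr>). f x \<noteq> \<zero>\<^bsub>M\<^esub>"
proof -
  let ?N = "(\<lambda>r. r \<odot>\<^bsub>M\<^esub> x) ` carrier R"
  note N = submodule_cyclic[OF x(1)]
  have "star R M ?N L \<noteq> {\<zero>\<^bsub>M\<^esub>}" using assms(1) N cyclic_nonzero[OF x] L unfolding star_prime_def by blast
  then obtain f r where f: "f \<in> mod_hom R M (M\<lparr>carrier := L\<rparr>)"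
    and r: "r \<in> carrier R" "f (r \<odot>\<^bsub>M\<^esub> x) \<noteq> \<zero>\<^bsub>M\<^esub>"
    using star_nonzeroD[OF submoduleD(1)[OF N], of L] by blast
  have "f x \<noteq> \<zero>\<^bsub>M\<^esub>" using r mod_homD(4)[OF f r(1) x(1)] by auto
  then show ?thesis using f by blast
qed

text \<open>One non-singular element gives a non-zero submodule \<open>L\<close> with an embedding
  \<open>g\<close> into \<open>R\<close>. By star-primeness \<open>L\<close> cogenerates
  \<open>M\<close>, and following a homomorphism to \<open>L\<close> by \<open>g\<close> loses no
  non-zero value.\<close>

lemma torsionless_if_star_prime:
  assumes "left_module R M" "star_prime R M" "\<not> singular R M"
  shows "torsionless R M"
  unfolding torsionless_iff[OF assms(1)]
proof (intro ballI impI)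
  interpret left_module R M by fact
  obtain m where m: "m \<in> carrier M" "m \<notin> singular_elements R M"
    using assms(3) by (auto simp: singular_def singular_elements_def)
  obtain L g where L: "submodule L R M" "L \<noteq> {\<zero>\<^bsub>M\<^esub>}"
    and g: "g \<in> mod_hom R (M\<lparr>carrier := L\<rparr>) (left_regular R)" "inj_on g L"
    using exists_embedded_left_ideal[OF m] by blast
  fix x assume x: "x \<in> carrier M" "x \<noteq> \<zero>\<^bsub>M\<^esub>"
  obtain f where f: "f \<in> mod_hom R M (M\<lparr>carrier := L\<rparr>)" "f x \<noteq> \<zero>\<^bsub>M\<^esub>"
    using star_primeD[OF assms(2) x L] by blast
  have "g \<zero>\<^bsub>M\<^esub> = \<zero>\<^bsub>R\<^esub>"
    using mod_hom_zero[OF left_module_submodule[OF L(1)] R.left_module_left_regular g(1)] by simp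
  then have "g (f x) \<noteq> \<zero>\<^bsub>R\<^esub>"
    using inj_onD[OF g(2), of "f x" "\<zero>\<^bsub>M\<^esub>"] f(2) mod_homD(2)[OF f(1) x(1)] submoduleD(2)[OF L(1)]
    by auto
  then show "\<exists>f \<in> mod_hom R M (left_regular R). f x \<noteq> \<zero>\<^bsub>R\<^esub>"
    using mod_hom_compose[OF assms(1) f(1) g(1)] x(1)
    by (intro bexI[where x = "compose (carrier M) g f"]) (auto simp: compose_def)
qed

text \<open>This reduces the left duo case to the first one: some non-zero \<open>x\<close> has zero
  annihilator, and the zero ideal is not essential in a non-zero ring.\<close>

lemma not_singular_if_left_duo:
  assumes "prime_ring R" "left_module R M" "faithful R M" "star_prime R M" "left_duo R"
  shows "\<not> singular R M"
proof -
  interpret R: prime_ring R by fact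
  interpret left_module R M by fact
  obtain x where x: "x \<in> carrier M" "x \<noteq> \<zero>\<^bsub>M\<^esub>"
    using exists_nonzero_if_faithful[OF assms(1-3)] by blast
  let ?L = "(\<lambda>r. r \<odot>\<^bsub>M\<^esub> x) ` carrier R"
  note L = submodule_cyclic[OF x(1)] and L0 = cyclic_nonzero[OF x]
  have ideal: "ideal (annihilator R M x) R"
    using left_ideal_annihilator[OF x(1)] assms(5) by (simp add: left_duo_def)
  have "a \<odot>\<^bsub>M\<^esub> y = \<zero>\<^bsub>M\<^esub>" if a: "a \<in> annihilator R M x" and y: "y \<in> carrier M" for a y
  proof (rule ccontr)
    assume "a \<odot>\<^bsub>M\<^esub> y \<noteq> \<zero>\<^bsub>M\<^esub>"
    have aR: "a \<in> carrier R" using a by (simp add: annihilator_def)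
    obtain f where f: "f \<in> mod_hom R M (M\<lparr>carrier := ?L\<rparr>)" "f (a \<odot>\<^bsub>M\<^esub> y) \<noteq> \<zero>\<^bsub>M\<^esub>"
      using star_primeD[OF assms(4) _ \<open>a \<odot>\<^bsub>M\<^esub> y \<noteq> \<zero>\<^bsub>M\<^esub>\<close> L L0] aR y by blast
    obtain r where r: "r \<in> carrier R" "f y = r \<odot>\<^bsub>M\<^esub> x" using mod_homD(2)[OF f(1) y] by auto
    \<comment> \<open>Here f(a y) = a(r x), and the annihilator of \<open>x\<close>, being
      two-sided, contains the product of \<open>a\<close> and \<open>r\<close>.\<close>
    have "f (a \<odot>\<^bsub>M\<^esub> y) = (a \<otimes>\<^bsub>R\<^esub> r) \<odot>\<^bsub>M\<^esub> x"
      using mod_homD(4)[OF f(1) aR y] r aR x(1) by (simp add: smult_assoc1)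
    then show False
      using f(2) ideal.I_r_closed[OF ideal a r(1)] by (simp add: annihilator_def)
  qed
  then have "annihilator R M x \<subseteq> {\<zero>\<^bsub>R\<^esub>}"
    using assms(3) unfolding faithful_def annihilator_def by blast
  \<comment> \<open>The whole ring serves as the non-zero left ideal that refutes
    essentiality.\<close>
  then have "annihilator R M x \<inter> carrier R = {\<zero>\<^bsub>R\<^esub>}" using x(1) by (auto simp: annihilator_def)
  moreover have "carrier R \<noteq> {\<zero>\<^bsub>R\<^esub>}" using R.one_not_zero R.one_closed by blast
  ultimately have "x \<notin> singular_elements R M"
    using R.left_ideal_carrier by (auto simp: singular_elements_def essential_submodule_def left_ideal_def)
  then show ?thesis using x(1) by (auto simp: singular_def)
qed

section \<open>Partial embeddings into powers\<close>

text \<open>\<open>G\<close> is the graph of an injective homomorphism from a submodule \<open>E\<close> of \<open>M\<close> to the power of \<open>U\<close>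
  indexed by all elements of \<open>M\<close>, with values supported on the coordinates in \<open>E\<close>. The coordinates
  outside \<open>E\<close> remain free for extending it.\<close>

locale embedding_graph =
  fixes R :: "('r, 'a) ring_scheme" and M :: "('r, 'm, 'b) module_scheme"
    and U :: "('r, 'u, 'c) module_scheme" and G :: "('m \<times> ('m \<Rightarrow> 'u)) set"
  assumes carrier_fst: "(x, v) \<in> G \<Longrightarrow> x \<in> carrier M"
    and carrier_snd: "(x, v) \<in> G \<Longrightarrow> v i \<in> carrier U"
    and zero: "(\<zero>\<^bsub>M\<^esub>, \<lambda>_. \<zero>\<^bsub>U\<^esub>) \<in> G"
    and add: "\<lbrakk>(x, v) \<in> G; (y, w) \<in> G\<rbrakk> \<Longrightarrow> (x \<oplus>\<^bsub>M\<^esub> y, \<lambda>i. v i \<oplus>\<^bsub>U\<^esub> w i) \<in> G"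
    and smult: "\<lbrakk>r \<in> carrier R; (x, v) \<in> G\<rbrakk> \<Longrightarrow> (r \<odot>\<^bsub>M\<^esub> x, \<lambda>i. r \<odot>\<^bsub>U\<^esub> v i) \<in> G"
    and single_valued: "(\<zero>\<^bsub>M\<^esub>, v) \<in> G \<Longrightarrow> v = (\<lambda>_. \<zero>\<^bsub>U\<^esub>)"
    and injective: "(x, \<lambda>_. \<zero>\<^bsub>U\<^esub>) \<in> G \<Longrightarrow> x = \<zero>\<^bsub>M\<^esub>"
    and support: "\<lbrakk>(x, v) \<in> G; i \<notin> fst ` G\<rbrakk> \<Longrightarrow> v i = \<zero>\<^bsub>U\<^esub>"

text \<open>Each closure condition involves at most two elements of the graph, and these lie in a
  common member of the chain. For the support condition, an index outside the domain of the union is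
  outside the domain of every member.\<close>

lemma embedding_graph_Union:
  assumes ne: "C \<noteq> {}" and chain: "subset.chain {G. embedding_graph R M U G} C"
  shows "embedding_graph R M U (\<Union>C)"
proof
  have G: "embedding_graph R M U G" if "G \<in> C" for G
    using chain that unfolding subset.chain_def by blast
  have common: "\<exists>G \<in> C. p \<in> G \<and> q \<in> G" if "p \<in> \<Union>C" "q \<in> \<Union>C" for p q
    using chain that unfolding subset_chain_def by blast
  show "x \<in> carrier M" if "(x, v) \<in> \<Union>C" for x v
    using that embedding_graph.carrier_fst[OF G] by blast
  show "v i \<in> carrier U" if "(x, v) \<in> \<Union>C" for x v i
    using that embedding_graph.carrier_snd[OF G] by blast
  show "(\<zero>\<^bsub>M\<^esub>, \<lambda>_. \<zero>\<^bsub>U\<^esub>) \<in> \<Union>C"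
    using ne embedding_graph.zero[OF G] by blast
  show "(x \<oplus>\<^bsub>M\<^esub> y, \<lambda>i. v i \<oplus>\<^bsub>U\<^esub> w i) \<in> \<Union>C" if "(x, v) \<in> \<Union>C" "(y, w) \<in> \<Union>C" for x v y w
    using common[OF that] embedding_graph.add[OF G] by blast
  show "(r \<odot>\<^bsub>M\<^esub> x, \<lambda>i. r \<odot>\<^bsub>U\<^esub> v i) \<in> \<Union>C" if "r \<in> carrier R" "(x, v) \<in> \<Union>C" for r x v
    using that embedding_graph.smult[OF G] by blast
  show "v = (\<lambda>_. \<zero>\<^bsub>U\<^esub>)" if "(\<zero>\<^bsub>M\<^esub>, v) \<in> \<Union>C" for v
    using that embedding_graph.single_valued[OF G] by blast
  show "x = \<zero>\<^bsub>M\<^esub>" if "(x, \<lambda>_. \<zero>\<^bsub>U\<^esub>) \<in> \<Union>C" for x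
    using that embedding_graph.injective[OF G] by blast
  show "v i = \<zero>\<^bsub>U\<^esub>" if "(x, v) \<in> \<Union>C" "i \<notin> fst ` \<Union>C" for x v i
  proof -
    from that(1) obtain G' where "G' \<in> C" "(x, v) \<in> G'" by blast
    moreover from this have "i \<notin> fst ` G'" using that(2) by blast
    ultimately show ?thesis using embedding_graph.support[OF G] by metis
  qed
qed

context embedding_graph
begin

lemma submodule_fst:
  assumes "left_module R M"
  shows "submodule (fst ` G) R M"
proof -
  interpret M: left_module R M by fact
  show ?thesis
  proof (rule M.submoduleI)
    show "fst ` G \<subseteq> carrier M" using carrier_fst by auto
    show "\<zero>\<^bsub>M\<^esub> \<in> fst ` G" using zero by force
    show "x \<oplus>\<^bsub>M\<^esub> y \<in> fst ` G" if "x \<in> fst ` G" "y \<in> fst ` G" for x y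
      using that add by force
    show "r \<odot>\<^bsub>M\<^esub> x \<in> fst ` G" if "r \<in> carrier R" "x \<in> fst ` G" for r x
      using that smult by force
  qed
qed

lemma extend:
  assumes M: "left_module R M" and U: "left_module R U" and L: "submodule L R M"
    and g: "g \<in> mod_hom R (M\<lparr>carrier := L\<rparr>) U" and inj: "inj_on g L"
    and EL: "fst ` G \<inter> L = {\<zero>\<^bsub>M\<^esub>}" and l: "l \<in> L" "l \<noteq> \<zero>\<^bsub>M\<^esub>"
  shows "\<exists>H. embedding_graph R M U H \<and> G \<subseteq> H \<and> l \<in> fst ` H"
proof -
  interpret M: left_module R M by fact
  interpret U: left_module R U by fact
  note E = submodule_fst[OF M]
  note L' = M.submoduleD[OF L] and g' = mod_homD[OF g, simplified]
  have g0: "g \<zero>\<^bsub>M\<^esub> = \<zero>\<^bsub>U\<^esub>" using mod_hom_zero[OF M.left_module_submodule[OF L] U g] by simp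
  have lE: "l \<notin> fst ` G" using l EL by blast
  have Gl: "v l = \<zero>\<^bsub>U\<^esub>" if "(x, v) \<in> G" for x v using support[OF that] lE by simp
  define H where "H = {(x \<oplus>\<^bsub>M\<^esub> y, v(l := g y)) | x v y. (x, v) \<in> G \<and> y \<in> L}"
  have HI: "(x \<oplus>\<^bsub>M\<^esub> y, v(l := g y)) \<in> H" if "(x, v) \<in> G" "y \<in> L" for x v y
    using that by (auto simp: H_def)
  have GH: "G \<subseteq> H"
  proof (rule subrelI)
    fix x v assume xv: "(x, v) \<in> G"
    \<comment> \<open>Taking the zero element of \<open>L\<close> changes nothing, since
      \<open>v\<close> already vanishes at \<open>l\<close>.\<close>
    have "v(l := g \<zero>\<^bsub>M\<^esub>) = v" using Gl[OF xv] by (auto simp: g0)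
    then show "(x, v) \<in> H" using HI[OF xv L'(2)] carrier_fst[OF xv] by simp
  qed
  have "l \<in> fst ` H"
    using HI[OF zero l(1)] l(1) L'(1) by (force simp: image_iff)
  have "embedding_graph R M U H"
  proof
    show "p \<in> carrier M" "w i \<in> carrier U" if "(p, w) \<in> H" for p w i
      using that carrier_fst carrier_snd L'(1) g'(2) by (auto simp: H_def)
    show "(\<zero>\<^bsub>M\<^esub>, \<lambda>_. \<zero>\<^bsub>U\<^esub>) \<in> H" using zero GH by blast
  next
    fix p v q w assume "(p, v) \<in> H" "(q, w) \<in> H"
    then obtain x v' y x' w' y' where *: "(x, v') \<in> G" "y \<in> L" "p = x \<oplus>\<^bsub>M\<^esub> y" "v = v'(l := g y)"
      "(x', w') \<in> G" "y' \<in> L" "q = x' \<oplus>\<^bsub>M\<^esub> y'" "w = w'(l := g y')"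
      unfolding H_def by blast
    have "p \<oplus>\<^bsub>M\<^esub> q = (x \<oplus>\<^bsub>M\<^esub> x') \<oplus>\<^bsub>M\<^esub> (y \<oplus>\<^bsub>M\<^esub> y')"
      using * carrier_fst L'(1) by (auto simp: M.M.a_ac subset_iff)
    moreover have "(\<lambda>i. v i \<oplus>\<^bsub>U\<^esub> w i) = (\<lambda>i. v' i \<oplus>\<^bsub>U\<^esub> w' i)(l := g (y \<oplus>\<^bsub>M\<^esub> y'))"
      using * g'(3) by auto
    ultimately show "(p \<oplus>\<^bsub>M\<^esub> q, \<lambda>i. v i \<oplus>\<^bsub>U\<^esub> w i) \<in> H"
      using HI[OF add[OF *(1,5)] L'(3)[OF *(2,6)]] by simp
  next
    fix r p v assume r: "r \<in> carrier R" and "(p, v) \<in> H"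
    then obtain x v' y where *: "(x, v') \<in> G" "y \<in> L" "p = x \<oplus>\<^bsub>M\<^esub> y" "v = v'(l := g y)"
      unfolding H_def by blast
    have "r \<odot>\<^bsub>M\<^esub> p = r \<odot>\<^bsub>M\<^esub> x \<oplus>\<^bsub>M\<^esub> r \<odot>\<^bsub>M\<^esub> y"
      using * r carrier_fst L'(1) by (auto simp: M.smult_r_distr subset_iff)
    moreover have "(\<lambda>i. r \<odot>\<^bsub>U\<^esub> v i) = (\<lambda>i. r \<odot>\<^bsub>U\<^esub> v' i)(l := g (r \<odot>\<^bsub>M\<^esub> y))"
      using * r g'(4) by auto
    ultimately show "(r \<odot>\<^bsub>M\<^esub> p, \<lambda>i. r \<odot>\<^bsub>U\<^esub> v i) \<in> H"
      using HI[OF smult[OF r *(1)] L'(4)[OF r *(2)]] by simp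
  next
    fix w assume "(\<zero>\<^bsub>M\<^esub>, w) \<in> H"
    then obtain x v y where *: "(x, v) \<in> G" "y \<in> L" "\<zero>\<^bsub>M\<^esub> = x \<oplus>\<^bsub>M\<^esub> y" "w = v(l := g y)"
      unfolding H_def by blast
    have carr: "x \<in> carrier M" "y \<in> carrier M" using * carrier_fst L'(1) by auto
    \<comment> \<open>If x + y = 0, then y = -x lies both in the domain of \<open>G\<close> and in
      \<open>L\<close>, so both summands are zero.\<close>
    have "x \<in> fst ` G" using *(1) by force
    then have "\<ominus>\<^bsub>M\<^esub> x \<in> fst ` G"
      using M.submoduleD(4)[OF E, of "\<ominus>\<^bsub>R\<^esub> \<one>\<^bsub>R\<^esub>" x] carr
      by (simp add: M.smult_minus_one)
    moreover have "y = \<ominus>\<^bsub>M\<^esub> x"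
      using *(3) carr by (metis M.M.add.m_comm M.M.minus_equality)
    ultimately have "y = \<zero>\<^bsub>M\<^esub>" using EL *(2) by blast
    moreover from this have "x = \<zero>\<^bsub>M\<^esub>" using *(3)[symmetric] carr by simp
    then have "v = (\<lambda>_. \<zero>\<^bsub>U\<^esub>)" using single_valued *(1) by blast
    ultimately show "w = (\<lambda>_. \<zero>\<^bsub>U\<^esub>)" using *(4) g0 by (simp add: fun_upd_idem)
  next
    fix p assume "(p, \<lambda>_. \<zero>\<^bsub>U\<^esub>) \<in> H"
    then obtain x v y where *: "(x, v) \<in> G" "y \<in> L" "p = x \<oplus>\<^bsub>M\<^esub> y"
      "(\<lambda>_. \<zero>\<^bsub>U\<^esub>) = v(l := g y)"
      unfolding H_def by blast
    \<comment> \<open>Coordinate \<open>l\<close> sees only \<open>g y\<close>, and the remaining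
      coordinates see only \<open>v\<close>; injectivity of \<open>g\<close> and of the old graph
      then apply separately.\<close>
    have "g y = \<zero>\<^bsub>U\<^esub>" using fun_cong[OF *(4), of l] by simp
    then have "y = \<zero>\<^bsub>M\<^esub>" using inj_onD[OF inj, of y "\<zero>\<^bsub>M\<^esub>"] *(2) L'(2) g0 by simp
    moreover have "v i = \<zero>\<^bsub>U\<^esub>" for i
      using fun_cong[OF *(4), of i] Gl[OF *(1)] by (cases "i = l") auto
    then have "v = (\<lambda>_. \<zero>\<^bsub>U\<^esub>)" by blast
    then have "x = \<zero>\<^bsub>M\<^esub>" using injective *(1) by blast
    ultimately show "p = \<zero>\<^bsub>M\<^esub>" using *(3) by simp
  next
    fix p w i assume "(p, w) \<in> H" and i: "i \<notin> fst ` H"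
    then obtain x v y where *: "(x, v) \<in> G" "w = v(l := g y)"
      unfolding H_def by blast
    \<comment> \<open>The only altered coordinate is \<open>l\<close>, which belongs to the new
      domain.\<close>
    have "i \<notin> fst ` G" "i \<noteq> l" using i GH \<open>l \<in> fst ` H\<close> by auto
    then show "w i = \<zero>\<^bsub>U\<^esub>" using support[OF *(1)] *(2) by simp
  qed
  then show ?thesis using GH \<open>l \<in> fst ` H\<close> by blast
qed

text \<open>The graph is that of an additive, scalar-compatible function on its domain. Its
  coordinates are homomorphisms to \<open>U\<close>, and injectivity says that a non-zero element
  has a non-zero coordinate.\<close>

lemma cogenerated_fst:
  assumes M: "left_module R M" and U: "left_module R U"
  shows "cogenerated_by R (M\<lparr>carrier := fst ` G\<rparr>) U"
proof -
  interpret M: left_module R M by fact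
  interpret U: left_module R U by fact
  define E where "E = fst ` G"
  have E: "submodule E R M" unfolding E_def by (rule submodule_fst[OF M])
  note E' = M.submoduleD[OF E]
  have unique: "v = w" if "(x, v) \<in> G" "(x, w) \<in> G" for x v w
  proof
    fix i
    \<comment> \<open>The difference of two values at \<open>x\<close> is a value at zero, where the
      graph is single-valued by assumption.\<close>
    have "(x \<oplus>\<^bsub>M\<^esub> (\<ominus>\<^bsub>R\<^esub> \<one>\<^bsub>R\<^esub>) \<odot>\<^bsub>M\<^esub> x, \<lambda>i. v i \<oplus>\<^bsub>U\<^esub> (\<ominus>\<^bsub>R\<^esub> \<one>\<^bsub>R\<^esub>) \<odot>\<^bsub>U\<^esub> w i) \<in> G"
      using that by (intro add smult) auto
    then have "(\<zero>\<^bsub>M\<^esub>, \<lambda>i. v i \<ominus>\<^bsub>U\<^esub> w i) \<in> G"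
      using carrier_fst[OF that(1)] carrier_snd[OF that(2)]
      by (simp add: M.smult_minus_one U.smult_minus_one M.M.r_neg a_minus_def)
    then have "v i \<ominus>\<^bsub>U\<^esub> w i = \<zero>\<^bsub>U\<^esub>" by (rule fun_cong[OF single_valued])
    then show "v i = w i"
      by (rule U.M.eq_if_minus_zero) (rule that[THEN carrier_snd])+
  qed
  have "\<forall>x \<in> E. \<exists>v. (x, v) \<in> G" by (auto simp: E_def)
  \<comment> \<open>Any choice will do: \<open>unique\<close> identifies the chosen value at a sum
    or multiple with the one that closure of the graph provides.\<close>
  then obtain V where V: "\<And>x. x \<in> E \<Longrightarrow> (x, V x) \<in> G" by metis
  have hom: "(\<lambda>x \<in> E. V x i) \<in> mod_hom R (M\<lparr>carrier := E\<rparr>) U" for i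
  proof (rule mod_homI)
    fix x y assume "x \<in> carrier (M\<lparr>carrier := E\<rparr>)" "y \<in> carrier (M\<lparr>carrier := E\<rparr>)"
    then have "x \<in> E" "y \<in> E" by auto
    then show "(\<lambda>x \<in> E. V x i) (x \<oplus>\<^bsub>M\<lparr>carrier := E\<rparr>\<^esub> y) = (\<lambda>x \<in> E. V x i) x \<oplus>\<^bsub>U\<^esub> (\<lambda>x \<in> E. V x i) y"
      using unique[OF V[OF E'(3)] add[OF V V]] E'(3) by simp
  next
    fix r x assume "r \<in> carrier R" "x \<in> carrier (M\<lparr>carrier := E\<rparr>)"
    then have "r \<in> carrier R" "x \<in> E" by auto
    then show "(\<lambda>x \<in> E. V x i) (r \<odot>\<^bsub>M\<lparr>carrier := E\<rparr>\<^esub> x) = r \<odot>\<^bsub>U\<^esub> (\<lambda>x \<in> E. V x i) x"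
      using unique[OF V[OF E'(4)] smult[OF _ V]] E'(4) by simp
  qed (use carrier_snd[OF V] in auto)
  show ?thesis
    unfolding E_def[symmetric] cogenerated_by_iff[OF M.left_module_submodule[OF E] U]
  proof (intro ballI impI)
    fix x assume "x \<in> carrier (M\<lparr>carrier := E\<rparr>)" "x \<noteq> \<zero>\<^bsub>M\<lparr>carrier := E\<rparr>\<^esub>"
    then have x: "x \<in> E" "x \<noteq> \<zero>\<^bsub>M\<^esub>" by auto
    have "V x \<noteq> (\<lambda>_. \<zero>\<^bsub>U\<^esub>)" using injective V[OF x(1)] x(2) by metis
    then obtain i where "V x i \<noteq> \<zero>\<^bsub>U\<^esub>" by blast
    then show "\<exists>f \<in> mod_hom R (M\<lparr>carrier := E\<rparr>) U. f x \<noteq> \<zero>\<^bsub>U\<^esub>"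
      using x(1) by (intro bexI[OF _ hom[of i]]) simp
  qed
qed

end

section \<open>Essential submodules and the third case\<close>

text \<open>Take \<open>E\<close> to be the domain of a maximal graph. If a non-zero submodule met
  \<open>E\<close> in zero, it would contain a non-zero \<open>L\<close> that embeds in
  \<open>U\<close>, and adjoining \<open>L\<close> would enlarge the graph.\<close>

lemma essential_cogenerated_submodule:
  assumes M: "left_module R M" and U: "left_module R U"
    and embed: "\<And>N. \<lbrakk>submodule N R M; N \<noteq> {\<zero>\<^bsub>M\<^esub>}\<rbrakk> \<Longrightarrow> \<exists>L g. submodule L R M \<and> L \<subseteq> N \<and>
      L \<noteq> {\<zero>\<^bsub>M\<^esub>} \<and> g \<in> mod_hom R (M\<lparr>carrier := L\<rparr>) U \<and> inj_on g L"
  shows "\<exists>E. essential_submodule R M E \<and> cogenerated_by R (M\<lparr>carrier := E\<rparr>) U"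
proof -
  interpret M: left_module R M by fact
  interpret U: left_module R U by fact
  \<comment> \<open>The graph of the zero map on the zero submodule gives Zorn's lemma a non-empty
    family.\<close>
  have "embedding_graph R M U {(\<zero>\<^bsub>M\<^esub>, \<lambda>_. \<zero>\<^bsub>U\<^esub>)}" by unfold_locales auto
  then have "\<exists>G \<in> {G. embedding_graph R M U G}. \<forall>H \<in> {G. embedding_graph R M U G}. G \<subseteq> H \<longrightarrow> H = G"
    by (intro subset_Zorn_nonempty) (auto intro: embedding_graph_Union)
  then obtain G where G: "embedding_graph R M U G"
    and max: "\<And>H. \<lbrakk>embedding_graph R M U H; G \<subseteq> H\<rbrakk> \<Longrightarrow> H = G" by blast
  interpret G: embedding_graph R M U G by (rule G)
  define E where "E = fst ` G"
  have E: "submodule E R M" unfolding E_def by (rule G.submodule_fst[OF M])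
  note E' = M.submoduleD[OF E]
  have "essential_submodule R M E"
    unfolding essential_submodule_def
  proof (intro conjI allI impI E notI)
    fix N assume N: "submodule N R M" "N \<noteq> {\<zero>\<^bsub>M\<^esub>}" and EN: "E \<inter> N = {\<zero>\<^bsub>M\<^esub>}"
    obtain L g where L: "submodule L R M" "L \<subseteq> N" "L \<noteq> {\<zero>\<^bsub>M\<^esub>}"
      and g: "g \<in> mod_hom R (M\<lparr>carrier := L\<rparr>) U" "inj_on g L"
      using embed[OF N] by blast
    obtain l where l: "l \<in> L" "l \<noteq> \<zero>\<^bsub>M\<^esub>" using L(3) M.submoduleD(2)[OF L(1)] by blast
    have EL: "fst ` G \<inter> L = {\<zero>\<^bsub>M\<^esub>}"
      using EN L(2) E'(2) M.submoduleD(2)[OF L(1)] unfolding E_def by blast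
    obtain H where "embedding_graph R M U H" "G \<subseteq> H" "l \<in> fst ` H"
      using G.extend[OF M U L(1) g EL l] by blast
    \<comment> \<open>By maximality \<open>H\<close> equals \<open>G\<close>, so \<open>l\<close>
      already lies in the domain, although \<open>E\<close> and \<open>N\<close> meet only in
      zero.\<close>
    then have "l \<in> E" using max by (metis E_def)
    then show False using l EN L(2) by blast
  qed
  then show ?thesis using G.cogenerated_fst[OF M U] unfolding E_def by blast
qed

lemma cogenerated_by_trans:
  assumes M: "left_module R M" and N: "left_module R N" and U: "left_module R U"
    and MN: "cogenerated_by R M N" and NU: "cogenerated_by R N U"
  shows "cogenerated_by R M U"
  unfolding cogenerated_by_iff[OF M U]
proof (intro ballI impI)
  fix x assume x: "x \<in> carrier M" "x \<noteq> \<zero>\<^bsub>M\<^esub>"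
  obtain f where f: "f \<in> mod_hom R M N" "f x \<noteq> \<zero>\<^bsub>N\<^esub>"
    using MN x unfolding cogenerated_by_iff[OF M N] by blast
  obtain g where g: "g \<in> mod_hom R N U" "g (f x) \<noteq> \<zero>\<^bsub>U\<^esub>"
    using NU f(2) mod_homD(2)[OF f(1) x(1)] unfolding cogenerated_by_iff[OF N U] by blast
  show "\<exists>h \<in> mod_hom R M U. h x \<noteq> \<zero>\<^bsub>U\<^esub>"
    using g(2) x(1) by (intro bexI[OF _ mod_hom_compose[OF M f(1) g(1)]]) (simp add: compose_def)
qed

text \<open>Every non-zero submodule contains a non-singular element and hence a non-zero submodule
  that embeds in \<open>R\<close>. So some essential \<open>E\<close> is torsionless, and
  \<open>M\<close>, being cogenerated by \<open>E\<close>, inherits this by transitivity.\<close>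

lemma torsionless_if_nonsingular:
  assumes M: "left_module R M" and ns: "nonsingular R M"
    and cogen: "\<And>E. essential_submodule R M E \<Longrightarrow> cogenerated_by R M (M\<lparr>carrier := E\<rparr>)"
  shows "torsionless R M"
proof -
  interpret left_module R M by fact
  have "\<exists>L g. submodule L R M \<and> L \<subseteq> N \<and> L \<noteq> {\<zero>\<^bsub>M\<^esub>} \<and>
      g \<in> mod_hom R (M\<lparr>carrier := L\<rparr>) (left_regular R) \<and> inj_on g L"
    if N: "submodule N R M" "N \<noteq> {\<zero>\<^bsub>M\<^esub>}" for N
  proof -
    note N' = submoduleD[OF N(1)]
    obtain x where x: "x \<in> N" "x \<noteq> \<zero>\<^bsub>M\<^esub>" using N(2) N'(2) by blast
    then have "x \<in> carrier M" "x \<notin> singular_elements R M"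
      using N'(1) ns by (auto simp: nonsingular_def)
    moreover have "(\<lambda>r. r \<odot>\<^bsub>M\<^esub> x) ` carrier R \<subseteq> N" using N'(4) x(1) by blast
    ultimately show ?thesis using exists_embedded_left_ideal[of x] by (meson subset_trans)
  qed
  then obtain E where E: "essential_submodule R M E"
    "cogenerated_by R (M\<lparr>carrier := E\<rparr>) (left_regular R)"
    using essential_cogenerated_submodule[OF M R.left_module_left_regular] by blast
  have "left_module R (M\<lparr>carrier := E\<rparr>)"
    using E(1) by (simp add: essential_submodule_def left_module_submodule)
  then show ?thesis
    unfolding torsionless_def
    using cogenerated_by_trans[OF M _ R.left_module_left_regular cogen[OF E(1)] E(2)] by blast
qed

theorem mainTheorem6:
  fixes R :: "('r, 'a) ring_scheme" and M :: "('r, 'm, 'b) module_scheme"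
  assumes "prime_ring R"
    and "left_module R M"
    and "faithful R M"
    and "(star_prime R M \<and> \<not> singular R M)
       \<or> (star_prime R M \<and> left_duo R)
       \<or> (nonsingular R M \<and>
          (\<forall>E. essential_submodule R M E \<longrightarrow> cogenerated_by R M (M\<lparr>carrier := E\<rparr>)))"
  shows "torsionless R M \<and> prime_ring (End_ring R M)"
proof -
  have "torsionless R M"
    using assms(4) torsionless_if_star_prime[OF assms(2)] torsionless_if_nonsingular[OF assms(2)]
      not_singular_if_left_duo[OF assms(1-3)] by blast
  then show ?thesis using prime_End_ring_if_torsionless[OF assms(1-3)] by blast
qed

end
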